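(* Let $M=M[P,Q]$ be a connected lattice path matroid of rank $r$ and nullity $m$ that is not uniform. Then the Tutte connectivity $\lambda(M)$ equals $$k_M:=\min\{|n(j)| : P\text{ has an }NE\text{ corner at } j\text{ or } Q\text{ has an }EN\text{ corner at } j-1\}.$$ Furthermore, at least one exact $k_M$-separation of $M$ consists of some fundamental flat of $M$ and its complement.
   Context: Lattice paths start at $(0,0)$ and use steps $E=(1,0)$ and $N=(0,1)$, written as words in $\{E,N\}$; "step $j$" is the $j$-th letter. A path has an $NE$ corner at $h$ if step $h$ is $N$ and step $h+1$ is $E$, and an $EN$ corner at $h$ if step $h$ is $E$ and step $h+1$ is $N$. For lattice paths $P,Q$ from $(0,0)$ to $(m,r)$ with $P$ never going above $Q$, let $\mathcal{P}$ be the set of lattice paths from $(0,0)$ to $(m,r)$ going neither above $Q$ nor below $P$, and for $1\le i\le r$ let $N_i=\{j:\text{step } j \text{ is the } i\text{-th North step of some path in }\mathcal{P}\}$. $M[P,Q]$ is the transversal matroid on $[m+r]$ with presentation $(N_1,\ldots,N_r)$; its incidence function is $n(X)=\{i: X\cap N_i\ne\emptyset\}$, and $n(j)$ means $n(\{j\})$. For a positive integer $k$, a $k$-separation of a matroid $M$ is a partition of $E(M)$ into sets $X,Y$ each with at least $k$ elements such that $r(X)+r(Y)\le r(M)+k-1$; it is exact if equality holds. $\lambda(M)$ is the least $k$ such that $M$ has a $k$-separation ($\infty$ if none). A fundamental flat of a connected matroid $M$ is a flat $X$ with $M|X$ connected, $|X|>1$, $r(X)<r(M)$, such that for some spanning circuit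 $C$ of $M$, $X\cap C$ is a basis of $M|X$. *)

theory Defs
  imports Main "HOL-Library.Extended_Nat"
begin

section \<open>Matroids, via independent sets\<close>

text \<open>
  The notions below are defined for an arbitrary set system; they have their usual
  meaning when the system satisfies \<open>is_matroid\<close>, which is proved for transversal
  (hence lattice path) matroids at the end of this theory.
\<close>

datatype 'a indep_system = Indep_System (ground: "'a set") (indeps: "'a set set")

definition is_matroid :: "'a indep_system \<Rightarrow> bool" where
  "is_matroid M \<longleftrightarrow>
     finite (ground M) \<and>
     indeps M \<subseteq> Pow (ground M) \<and>
     {} \<in> indeps M \<and>
     (\<forall>X\<in>indeps M. \<forall>Y\<subseteq>X. Y \<in> indeps M) \<and>
     (\<forall>X\<in>indeps M. \<forall>Y\<in>indeps M. card X < card Y \<longrightarrow>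
        (\<exists>y\<in>Y - X. insert y X \<in> indeps M))"

definition rank_of :: "'a indep_system \<Rightarrow> 'a set \<Rightarrow> nat" where
  "rank_of M X = Max (card ` {I \<in> indeps M. I \<subseteq> X})"

abbreviation matroid_rank :: "'a indep_system \<Rightarrow> nat" where
  "matroid_rank M \<equiv> rank_of M (ground M)"

definition restriction :: "'a indep_system \<Rightarrow> 'a set \<Rightarrow> 'a indep_system" where
  "restriction M X = Indep_System (ground M \<inter> X) {I \<in> indeps M. I \<subseteq> X}"

definition basis :: "'a indep_system \<Rightarrow> 'a set \<Rightarrow> bool" where
  "basis M B \<longleftrightarrow> B \<in> indeps M \<and> (\<forall>I\<in>indeps M. B \<subseteq> I \<longrightarrow> I = B)"

definition circuit :: "'a indep_system \<Rightarrow> 'a set \<Rightarrow> bool" where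
  "circuit M C \<longleftrightarrow> C \<subseteq> ground M \<and> C \<notin> indeps M \<and> (\<forall>D. D \<subset> C \<longrightarrow> D \<in> indeps M)"

definition spanning :: "'a indep_system \<Rightarrow> 'a set \<Rightarrow> bool" where
  "spanning M X \<longleftrightarrow> X \<subseteq> ground M \<and> rank_of M X = matroid_rank M"

definition flat :: "'a indep_system \<Rightarrow> 'a set \<Rightarrow> bool" where
  "flat M X \<longleftrightarrow>
     X \<subseteq> ground M \<and> (\<forall>e\<in>ground M - X. rank_of M (insert e X) > rank_of M X)"

definition matroid_connected :: "'a indep_system \<Rightarrow> bool" where
  "matroid_connected M \<longleftrightarrow>
     (\<forall>x\<in>ground M. \<forall>y\<in>ground M. x \<noteq> y \<longrightarrow> (\<exists>C. circuit M C \<and> x \<in> C \<and> y \<in> C))"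

definition uniform :: "'a indep_system \<Rightarrow> bool" where
  "uniform M \<longleftrightarrow> (\<exists>k. indeps M = {X. X \<subseteq> ground M \<and> card X \<le> k})"

definition separation :: "'a indep_system \<Rightarrow> nat \<Rightarrow> 'a set \<Rightarrow> 'a set \<Rightarrow> bool" where
  "separation M k X Y \<longleftrightarrow>
     k \<ge> 1 \<and> X \<union> Y = ground M \<and> X \<inter> Y = {} \<and> card X \<ge> k \<and> card Y \<ge> k \<and>
     rank_of M X + rank_of M Y \<le> matroid_rank M + k - 1"

definition exact_separation :: "'a indep_system \<Rightarrow> nat \<Rightarrow> 'a set \<Rightarrow> 'a set \<Rightarrow> bool" where
  "exact_separation M k X Y \<longleftrightarrow>
     separation M k X Y \<and> rank_of M X + rank_of M Y = matroid_rank M + k - 1"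

definition tutte_connectivity :: "'a indep_system \<Rightarrow> enat" where
  "tutte_connectivity M =
     (if \<exists>k X Y. separation M k X Y then enat (LEAST k. \<exists>X Y. separation M k X Y) else \<infinity>)"

definition fundamental_flat :: "'a indep_system \<Rightarrow> 'a set \<Rightarrow> bool" where
  "fundamental_flat M X \<longleftrightarrow>
     flat M X \<and> matroid_connected (restriction M X) \<and> card X > 1 \<and>
     rank_of M X < matroid_rank M \<and>
     (\<exists>C. circuit M C \<and> spanning M C \<and> basis (restriction M X) (X \<inter> C))"

definition transversal_matroid :: "'a set \<Rightarrow> 'i set \<Rightarrow> ('i \<Rightarrow> 'a set) \<Rightarrow> 'a indep_system" where
  "transversal_matroid S I A =
     Indep_System S
       {X. X \<subseteq> S \<and> (\<exists>\<phi>. inj_on \<phi> X \<and> (\<forall>x\<in>X. \<phi> x \<in> I \<and> x \<in> A (\<phi> x)))}"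


section \<open>Lattice paths\<close>

datatype step = East | North

type_synonym path = "step list"

text \<open>Steps are numbered from 1.\<close>

definition path_step :: "path \<Rightarrow> nat \<Rightarrow> step" where
  "path_step p j = p ! (j - 1)"

definition lattice_paths :: "nat \<Rightarrow> nat \<Rightarrow> path set" where
  "lattice_paths m r = {p. count_list p East = m \<and> count_list p North = r}"

text \<open>The height (second coordinate) of the point reached after \<open>j\<close> steps.\<close>

definition height :: "path \<Rightarrow> nat \<Rightarrow> nat" where
  "height p j = count_list (take j p) North"

text \<open>
  After \<open>j\<close> steps both paths are on the antidiagonal \<open>x + y = j\<close>, so their
  positions there are compared by height.
\<close>

definition never_above :: "path \<Rightarrow> path \<Rightarrow> bool" where
  "never_above p q \<longleftrightarrow> (\<forall>j. height p j \<le> height q j)"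

definition NE_corner :: "path \<Rightarrow> nat \<Rightarrow> bool" where
  "NE_corner p h \<longleftrightarrow>
     1 \<le> h \<and> h + 1 \<le> length p \<and> path_step p h = North \<and> path_step p (h + 1) = East"

definition EN_corner :: "path \<Rightarrow> nat \<Rightarrow> bool" where
  "EN_corner p h \<longleftrightarrow>
     1 \<le> h \<and> h + 1 \<le> length p \<and> path_step p h = East \<and> path_step p (h + 1) = North"

definition paths_between :: "nat \<Rightarrow> nat \<Rightarrow> path \<Rightarrow> path \<Rightarrow> path set" where
  "paths_between m r P Q = {p \<in> lattice_paths m r. never_above p Q \<and> never_above P p}"

definition is_ith_North :: "path \<Rightarrow> nat \<Rightarrow> nat \<Rightarrow> bool" where
  "is_ith_North p i j \<longleftrightarrow>
     1 \<le> j \<and> j \<le> length p \<and> path_step p j = North \<and> height p j = i"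

definition north_set :: "nat \<Rightarrow> nat \<Rightarrow> path \<Rightarrow> path \<Rightarrow> nat \<Rightarrow> nat set" where
  "north_set m r P Q i = {j. \<exists>p\<in>paths_between m r P Q. is_ith_North p i j}"

definition lattice_path_matroid :: "nat \<Rightarrow> nat \<Rightarrow> path \<Rightarrow> path \<Rightarrow> nat indep_system" where
  "lattice_path_matroid m r P Q =
     transversal_matroid {1..m + r} {1..r} (north_set m r P Q)"

definition incidence :: "nat \<Rightarrow> nat \<Rightarrow> path \<Rightarrow> path \<Rightarrow> nat set \<Rightarrow> nat set" where
  "incidence m r P Q X = {i \<in> {1..r}. X \<inter> north_set m r P Q i \<noteq> {}}"

definition min_corner_incidence :: "nat \<Rightarrow> nat \<Rightarrow> path \<Rightarrow> path \<Rightarrow> nat" where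
  "min_corner_incidence m r P Q =
     Min {card (incidence m r P Q {j}) | j. NE_corner P j \<or> EN_corner Q (j - 1)}"


section \<open>Transversal matroids are matroids\<close>

lemma partial_transversal_augment:
  assumes "finite X" "finite Y" "card X < card Y"
    and "inj_on f X" "\<forall>x\<in>X. f x \<in> I \<and> x \<in> A (f x)"
    and "inj_on g Y" "\<forall>y\<in>Y. g y \<in> I \<and> y \<in> A (g y)"
  shows "\<exists>y\<in>Y - X. \<exists>h. inj_on h (insert y X) \<and>
           (\<forall>x\<in>insert y X. h x \<in> I \<and> x \<in> A (h x))"
  using assms(4,5)
proof (induction "card {x \<in> X. f x \<noteq> g x}" arbitrary: f rule: less_induct)
  case less
  have "card (f ` X) < card (g ` Y)"
    using assms less.prems by (simp add: card_image)
  then have "\<not> g ` Y \<subseteq> f ` X"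
    using assms(1) by (meson card_mono finite_imageI not_le)
  then obtain y where y: "y \<in> Y" "g y \<notin> f ` X" by blast
  let ?h = "f(y := g y)"
  have injX: "inj_on ?h X"
    using less.prems(1) y(2) by (rule inj_on_fun_updI)
  have "?h ` (X - {y}) = f ` (X - {y})"
    by (intro image_cong) auto
  then have inj: "inj_on ?h (insert y X)"
    using injX y(2) by (simp only: inj_on_insert) auto
  have mem: "?h x \<in> I \<and> x \<in> A (?h x)" if "x \<in> insert y X" for x
    using less.prems(2) assms(7) y(1) that by (cases "x = y") auto
  show ?case
  proof (cases "y \<in> X")
    case False
    then show ?thesis using y inj mem by blast
  next
    case True
    have "y \<in> {x \<in> X. f x \<noteq> g x} - {x \<in> X. ?h x \<noteq> g x}"
      using True y(2) by force
    moreover have "{x \<in> X. ?h x \<noteq> g x} \<subseteq> {x \<in> X. f x \<noteq> g x}"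
      by auto
    ultimately have "{x \<in> X. ?h x \<noteq> g x} \<subset> {x \<in> X. f x \<noteq> g x}"
      by blast
    then have lt: "card {x \<in> X. ?h x \<noteq> g x} < card {x \<in> X. f x \<noteq> g x}"
      using assms(1) by (intro psubset_card_mono) auto
    show ?thesis
    proof (rule less.hyps[OF lt])
      show "inj_on ?h X" by (rule injX)
      show "\<forall>x\<in>X. ?h x \<in> I \<and> x \<in> A (?h x)" using mem by blast
    qed
  qed
qed

lemma is_matroid_transversal_matroid:
  assumes "finite S"
  shows "is_matroid (transversal_matroid S I A)"
proof -
  let ?ind = "\<lambda>X. \<exists>\<phi>. inj_on \<phi> X \<and> (\<forall>x\<in>X. \<phi> x \<in> I \<and> x \<in> A (\<phi> x))"
  have aug: "\<exists>y\<in>Y - X. insert y X \<subseteq> S \<and> ?ind (insert y X)"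
    if XY: "X \<subseteq> S" "?ind X" "Y \<subseteq> S" "?ind Y" "card X < card Y" for X Y
  proof -
    obtain f g where fg: "inj_on f X" "\<forall>x\<in>X. f x \<in> I \<and> x \<in> A (f x)"
        "inj_on g Y" "\<forall>y\<in>Y. g y \<in> I \<and> y \<in> A (g y)"
      using XY by blast
    have fin: "finite X" "finite Y"
      using XY assms finite_subset by blast+
    obtain y where "y \<in> Y - X" "?ind (insert y X)"
      using partial_transversal_augment[OF fin XY(5) fg] by blast
    then show ?thesis using XY by blast
  qed
  have her: "?ind Y" if XY: "?ind X" "Y \<subseteq> X" for X Y
  proof -
    obtain f where "inj_on f X" "\<forall>x\<in>X. f x \<in> I \<and> x \<in> A (f x)"
      using XY(1) by blast
    then show ?thesis
      using XY(2) by (intro exI[of _ f] conjI) (auto intro: inj_on_subset)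
  qed
  let ?M = "transversal_matroid S I A"
  have indeps: "X \<in> indeps ?M \<longleftrightarrow> X \<subseteq> S \<and> ?ind X" for X
    by (simp add: transversal_matroid_def)
  have ground: "ground ?M = S"
    by (simp add: transversal_matroid_def)
  show ?thesis
    unfolding is_matroid_def ground
  proof (intro conjI ballI allI impI)
    show "finite S" by fact
    show "indeps ?M \<subseteq> Pow S" using indeps by blast
    show "{} \<in> indeps ?M" by (simp add: indeps)
    show "Y \<in> indeps ?M" if "X \<in> indeps ?M" "Y \<subseteq> X" for X Y
      using that her[of X Y] unfolding indeps by (meson subset_trans)
    show "\<exists>y\<in>Y - X. insert y X \<in> indeps ?M"
      if "X \<in> indeps ?M" "Y \<in> indeps ?M" "card X < card Y" for X Y
    proof -
      have XY: "X \<subseteq> S" "?ind X" "Y \<subseteq> S" "?ind Y"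
        using that(1,2) indeps by simp_all
      show ?thesis
        unfolding indeps by (rule aug[OF XY that(3)])
    qed
  qed
qed

corollary is_matroid_lattice_path_matroid: "is_matroid (lattice_path_matroid m r P Q)"
  by (simp add: lattice_path_matroid_def is_matroid_transversal_matroid)

end

theory Submission
  imports Defs
begin

text \<open>
  Let \<open>p \<le> q\<close> be the height functions of \<open>P\<close> and \<open>Q\<close>, so that \<open>N\<^sub>i = {j. p (j - 1) < i \<le> q j}\<close>.
  The prefix of length \<open>h\<close> has rank \<open>q h\<close> and its complement has rank \<open>r - p h\<close>; hence the gap
  \<open>q h - p h\<close> at a corner is \<open>\<bar>n(j)\<bar> - 1\<close>, and cutting there gives an exact
  \<open>\<bar>n(j)\<bar>\<close>-separation, one side of which is a fundamental flat.

  Conversely, if every corner has gap at least \<open>K\<close>, then for each \<open>t \<le> K\<close> the gap at \<open>j\<close> is at least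
  \<open>min t j (n - j)\<close>. The set \<open>C\<close> consisting of the first \<open>t\<close> elements and the North steps of \<open>P\<close>
  then carries a uniform matroid of rank \<open>r\<close> on \<open>r + t\<close> elements, while each element outside \<open>C\<close>
  lies in at least \<open>t\<close> of the sets \<open>N\<^sub>i\<close>, so every \<open>t\<close>-set is independent. Thus
  \<open>r(X) + r(Y) \<ge> r + t\<close> whenever \<open>X\<close>, \<open>Y\<close> are complementary of size at least \<open>t\<close>.
\<close>

section \<open>Matroids\<close>

lemma card_le_rank_of:
  assumes "is_matroid M" "I \<in> indeps M" "I \<subseteq> X"
  shows "card I \<le> rank_of M X"
proof -
  have "finite (indeps M)"
    using assms(1) finite_subset unfolding is_matroid_def by (metis finite_Pow_iff)
  then show ?thesis
    unfolding rank_of_def using assms by (intro Max_ge) auto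
qed

lemma rank_of_le:
  assumes "is_matroid M" "\<And>I. I \<in> indeps M \<Longrightarrow> I \<subseteq> X \<Longrightarrow> card I \<le> k"
  shows "rank_of M X \<le> k"
proof -
  have "finite (indeps M)"
    using assms(1) finite_subset unfolding is_matroid_def by (metis finite_Pow_iff)
  moreover have "{} \<in> indeps M"
    using assms(1) unfolding is_matroid_def by blast
  ultimately show ?thesis
    unfolding rank_of_def using assms(2) by (subst Max_le_iff) auto
qed

lemma indeps_subset_ground: "is_matroid M \<Longrightarrow> I \<in> indeps M \<Longrightarrow> I \<subseteq> ground M"
  unfolding is_matroid_def by blast

lemma finite_indep: "is_matroid M \<Longrightarrow> I \<in> indeps M \<Longrightarrow> finite I"
  unfolding is_matroid_def by (meson PowD finite_subset subsetD)

lemma indeps_subset: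
  "is_matroid M \<Longrightarrow> I \<in> indeps M \<Longrightarrow> J \<subseteq> I \<Longrightarrow> J \<in> indeps M"
  unfolding is_matroid_def by blast

lemma circuit_restriction_iff:
  "circuit (restriction M X) C \<longleftrightarrow> circuit M C \<and> C \<subseteq> X"
  unfolding circuit_def restriction_def by auto

text \<open>A smallest dependent subset of the whole set is a circuit; if it omitted
  \<open>x\<close> or \<open>y\<close>, it would lie in an independent set.\<close>

lemma circuit_through_exchanged_pair:
  assumes M: "is_matroid M" and x: "insert x A \<in> indeps M" and y: "insert y A \<in> indeps M"
    and dep: "insert x (insert y A) \<notin> indeps M"
  obtains C where "circuit M C" "x \<in> C" "y \<in> C" "C \<subseteq> insert x (insert y A)"
proof -
  let ?Z = "insert x (insert y A)"
  have Z: "?Z \<subseteq> ground M" "finite ?Z"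
    using M x y indeps_subset_ground[OF M] finite_indep[OF M x] by auto
  obtain C where C: "C \<subseteq> ?Z" "C \<notin> indeps M"
    and min: "\<And>D. D \<subseteq> ?Z \<Longrightarrow> D \<notin> indeps M \<Longrightarrow> card C \<le> card D"
    using ex_has_least_nat[of "\<lambda>D. D \<subseteq> ?Z \<and> D \<notin> indeps M" ?Z card] dep by auto
  have "finite C" using C Z finite_subset by blast
  then have "D \<in> indeps M" if "D \<subset> C" for D
    using min[of D] C(1) that psubset_card_mono[of C D] by (meson not_le psubset_imp_subset subset_trans)
  then have "circuit M C" unfolding circuit_def using C Z by blast
  moreover have "x \<in> C"
    using C indeps_subset[OF M y, of C] by blast
  moreover have "y \<in> C"
    using C indeps_subset[OF M x, of C] by blast
  ultimately show thesis using that C by blast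
qed

text \<open>A count replaces the basis condition. A spanning circuit has too large a rank to lie in
  \<open>X\<close>, so \<open>X \<inter> C\<close> is a proper, hence independent, subset of it, and
  its size makes it maximal in \<open>X\<close>.\<close>

lemma fundamental_flatI:
  assumes M: "is_matroid M" and "flat M X" "matroid_connected (restriction M X)" "card X > 1"
    and lt: "rank_of M X < matroid_rank M"
    and C: "circuit M C" "spanning M C" and card: "card (X \<inter> C) = rank_of M X"
  shows "fundamental_flat M X"
proof -
  have "\<not> C \<subseteq> X"
  proof
    assume "C \<subseteq> X"
    have "rank_of M C \<le> rank_of M X"
      using \<open>C \<subseteq> X\<close> by (intro rank_of_le[OF M] card_le_rank_of[OF M]) auto
    then show False using C(2) lt unfolding spanning_def by simp
  qed
  then have ind: "X \<inter> C \<in> indeps M" using C(1) unfolding circuit_def by blast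
  have "I = X \<inter> C" if "I \<in> indeps M" "I \<subseteq> X" "X \<inter> C \<subseteq> I" for I
  proof -
    have "finite I" using finite_indep[OF M that(1)] .
    then show ?thesis
      using that card_le_rank_of[OF M that(1,2)] card card_seteq[of I "X \<inter> C"] by simp
  qed
  then have "basis (restriction M X) (X \<inter> C)"
    using ind unfolding basis_def restriction_def by auto
  then show ?thesis
    unfolding fundamental_flat_def using assms by blast
qed

section \<open>Unit-step functions\<close>

text \<open>These are the height functions of lattice paths on the stretch from \<open>u\<close> to
  \<open>v\<close>. With paths as functions, new ones can be built by minima, maxima and
  shifts.\<close>

definition unit_steps :: "nat \<Rightarrow> nat \<Rightarrow> (nat \<Rightarrow> nat) \<Rightarrow> bool" where
  "unit_steps u v f \<longleftrightarrow> (\<forall>j. u \<le> j \<and> j < v \<longrightarrow> f (Suc j) = f j \<or> f (Suc j) = Suc (f j))"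

definition norths :: "(nat \<Rightarrow> nat) \<Rightarrow> nat \<Rightarrow> nat \<Rightarrow> nat set" where
  "norths f u v = {j \<in> {u<..v}. f j = Suc (f (j - 1))}"

lemma unit_stepsD:
  "unit_steps u v f \<Longrightarrow> u \<le> j \<Longrightarrow> j < v \<Longrightarrow> f (Suc j) = f j \<or> f (Suc j) = Suc (f j)"
  unfolding unit_steps_def by blast

lemma unit_steps_pred:
  "unit_steps u v f \<Longrightarrow> u < j \<Longrightarrow> j \<le> v \<Longrightarrow> f j = f (j - 1) \<or> f j = Suc (f (j - 1))"
  using unit_stepsD[of u v f "j - 1"] by auto

lemma unit_steps_subinterval:
  "unit_steps u v f \<Longrightarrow> u \<le> u' \<Longrightarrow> v' \<le> v \<Longrightarrow> unit_steps u' v' f"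
  unfolding unit_steps_def by auto

lemma unit_steps_bounds:
  assumes "unit_steps u v f" "u \<le> i" "i \<le> j" "j \<le> v"
  shows "f i \<le> f j" "f j \<le> f i + (j - i)"
proof -
  have "f i \<le> f j \<and> f j \<le> f i + (j - i)"
    using assms(3,4)
  proof (induction j rule: dec_induct)
    case (step j)
    then show ?case using unit_stepsD[OF assms(1), of j] assms(2) by fastforce
  qed simp
  then show "f i \<le> f j" "f j \<le> f i + (j - i)" by auto
qed

lemma finite_norths [simp]: "finite (norths f u v)"
  unfolding norths_def by simp

lemma inj_on_norths:
  assumes f: "unit_steps u v f"
  shows "inj_on f (norths f u v)"
proof (rule linorder_inj_onI')
  fix x y assume "x \<in> norths f u v" "y \<in> norths f u v" "x < y"
  then have "u \<le> x" "x \<le> y - 1" "y - 1 \<le> v" "f y = Suc (f (y - 1))"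
    unfolding norths_def by auto
  then show "f x \<noteq> f y" using unit_steps_bounds(1)[OF f, of x "y - 1"] by linarith
qed

lemma card_norths:
  assumes "unit_steps u v f" "u \<le> v"
  shows "f v = f u + card (norths f u v)"
  using assms(2,1)
proof (induction v rule: dec_induct)
  case base
  then show ?case by (simp add: norths_def)
next
  case (step v)
  have IH: "f v = f u + card (norths f u v)"
    using step unit_steps_subinterval by (metis le_Suc_eq order_refl)
  have "norths f u (Suc v) = (if f (Suc v) = Suc (f v) then insert (Suc v) (norths f u v) else norths f u v)"
    unfolding norths_def using step(1) by (auto simp: le_Suc_eq)
  moreover have "Suc v \<notin> norths f u v" unfolding norths_def by simp
  ultimately show ?case
    using IH unit_stepsD[OF step.prems, of v] step(1) by auto
qed

text \<open>The least position \<open>a\<close> of height \<open>f j\<close> ends a North step. If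
  \<open>a < j\<close>, an East step follows it; otherwise step \<open>j\<close> is itself North,
  and the run of North steps from there ends at a corner before \<open>n\<close> because of the
  bound on \<open>f n\<close>. The last conclusion says how the corner is reached from
  \<open>j\<close>, which controls the gap there.\<close>

lemma corner_near:
  assumes f: "unit_steps 0 n f" and "f 0 = 0" "0 < f j" "j \<le> n" "f n < f j + (n - j)"
  obtains h where "1 \<le> h" "h < n" "f h = Suc (f (h - 1))" "f (Suc h) = f h"
    "(h \<le> j \<and> f h = f j) \<or> (j \<le> h \<and> f h = f j + (h - j))"
proof -
  define a where "a = (LEAST a. f a = f j)"
  have fa: "f a = f j" unfolding a_def by (rule LeastI) simp
  have aj: "a \<le> j" unfolding a_def by (rule Least_le) simp
  have a0: "0 < a" using fa assms by (metis gr0I less_numeral_extra(3))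
  have "f (a - 1) \<noteq> f j"
    using not_less_Least[of "a - 1" "\<lambda>a. f a = f j"] a0 unfolding a_def by simp
  then have na: "f a = Suc (f (a - 1))"
    using unit_stepsD[OF f, of "a - 1"] a0 aj assms(4) fa by auto
  show thesis
  proof (cases "a < j")
    case True
    have "f (Suc a) = f a"
      using unit_steps_bounds[OF f, of a "Suc a"] unit_steps_bounds[OF f, of "Suc a" j]
        True assms(4) fa by simp
    then show thesis using that[of a] True a0 na fa assms(4) by simp
  next
    case False
    then have "a = j" using aj by simp
    let ?P = "\<lambda>b. j \<le> b \<and> b \<le> n \<and> f b = f j + (b - j)"
    define b where "b = (GREATEST b. ?P b)"
    have b: "?P b" unfolding b_def
      by (rule GreatestI_nat[of ?P j n]) (use assms in auto)
    have bmax: "c \<le> b" if "?P c" for c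
      unfolding b_def by (rule Greatest_le_nat[of ?P c n]) (use that in auto)
    have "b < n" using b assms by (metis le_neq_implies_less less_irrefl)
    have "f (Suc b) \<noteq> Suc (f b)" using bmax[of "Suc b"] b \<open>b < n\<close> by (auto simp: Suc_diff_le)
    then have e: "f (Suc b) = f b" using unit_stepsD[OF f, of b] \<open>b < n\<close> by auto
    have "f b = Suc (f (b - 1))"
    proof (cases "b = j")
      case True
      then show ?thesis using na \<open>a = j\<close> by simp
    next
      case False
      then have "j < b" using b by simp
      then have "f (b - 1) \<le> f j + (b - 1 - j)"
        using unit_steps_bounds(2)[OF f, of j "b - 1"] \<open>b < n\<close> by simp
      moreover have "f b = f (b - 1) \<or> f b = Suc (f (b - 1))"
        using unit_stepsD[OF f, of "b - 1"] \<open>b < n\<close> \<open>j < b\<close> by simp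
      ultimately show ?thesis using b \<open>j < b\<close> by linarith
    qed
    then show thesis using that[of b] e b \<open>b < n\<close> a0 \<open>a = j\<close> by simp
  qed
qed

text \<open>\<open>i - f i\<close> counts East steps, so \<open>corner_near\<close> applies to the
  path reflected in the diagonal.\<close>

lemma valley_near:
  assumes f: "unit_steps 0 n f" and "f 0 = 0" "j \<le> n" "f j < j" "f j < f n"
  obtains h where "1 \<le> h" "h < n" "f h = f (h - 1)" "f (Suc h) = Suc (f h)"
    "(h \<le> j \<and> f j = f h + (j - h)) \<or> (j \<le> h \<and> f h = f j)"
proof -
  have le: "f i \<le> i" if "i \<le> n" for i
    using unit_steps_bounds(2)[OF f, of 0 i] that assms(2) by simp
  let ?g = "\<lambda>i. i - f i"
  have "?g (Suc i) = ?g i \<or> ?g (Suc i) = Suc (?g i)" if "i < n" for i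
    using unit_stepsD[OF f, of i] le[of i] that by auto
  then have "unit_steps 0 n ?g" unfolding unit_steps_def by blast
  then obtain h where h: "1 \<le> h" "h < n" "?g h = Suc (?g (h - 1))" "?g (Suc h) = ?g h"
    "(h \<le> j \<and> ?g h = ?g j) \<or> (j \<le> h \<and> ?g h = ?g j + (h - j))"
    by (rule corner_near[of n ?g j]) (use assms in auto)
  have "f h = f (h - 1)" "f (Suc h) = Suc (f h)"
    using h(1-4) le[of h] le[of "h - 1"] le[of "Suc h"]
      unit_steps_pred[OF f, of h] unit_stepsD[OF f, of h] by auto
  moreover have "(h \<le> j \<and> f j = f h + (j - h)) \<or> (j \<le> h \<and> f h = f j)"
    using h(2,5) le[of h] le[of j] assms(3) by auto
  ultimately show thesis using that h by blast
qed

section \<open>The matroid of a band between two height functions\<close>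

definition band_matroid :: "nat \<Rightarrow> (nat \<Rightarrow> nat) \<Rightarrow> (nat \<Rightarrow> nat) \<Rightarrow> nat indep_system" where
  "band_matroid n p q = transversal_matroid {0<..n} UNIV (\<lambda>i. {j. p (j - 1) < i \<and> i \<le> q j})"

lemma is_matroid_band_matroid [simp]: "is_matroid (band_matroid n p q)"
  unfolding band_matroid_def by (rule is_matroid_transversal_matroid) simp

lemma ground_band_matroid [simp]: "ground (band_matroid n p q) = {0<..n}"
  unfolding band_matroid_def transversal_matroid_def by simp

lemma indeps_band_matroid:
  "X \<in> indeps (band_matroid n p q) \<longleftrightarrow>
     X \<subseteq> {0<..n} \<and> (\<exists>\<phi>. inj_on \<phi> X \<and> (\<forall>x\<in>X. p (x - 1) < \<phi> x \<and> \<phi> x \<le> q x))"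
  unfolding band_matroid_def transversal_matroid_def by simp

text \<open>This map matches the elements of \<open>D\<close> in increasing order with 1, 2, and so
  on; for independence of \<open>D\<close> it then remains to check the bounds from \<open>p\<close>
  and \<open>q\<close>.\<close>

lemma inj_on_initial_count:
  fixes D :: "nat set"
  assumes "finite D"
  shows "inj_on (\<lambda>x. card {y \<in> D. y \<le> x}) D"
proof (rule linorder_inj_onI')
  fix x y assume "x \<in> D" "y \<in> D" "x < y"
  then have "{z \<in> D. z \<le> x} \<subset> {z \<in> D. z \<le> y}" by force
  then show "card {z \<in> D. z \<le> x} \<noteq> card {z \<in> D. z \<le> y}"
    using psubset_card_mono[of "{z \<in> D. z \<le> y}" "{z \<in> D. z \<le> x}"] assms by simp
qed

lemma insert_indep_band_matroid:
  assumes "inj_on \<phi> I" and \<phi>: "\<And>x. x \<in> I \<Longrightarrow> p (x - 1) < \<phi> x \<and> \<phi> x \<le> q x" and "I \<subseteq> {0<..n}"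
    and y: "y \<in> {0<..n}" "y \<notin> I" and i: "p (y - 1) < i" "i \<le> q y" "i \<notin> \<phi> ` I"
  shows "insert y I \<in> indeps (band_matroid n p q)"
proof -
  have "inj_on (\<phi>(y := i)) (insert y I)"
    using inj_on_fun_updI[OF assms(1) i(3), of y] y i by auto
  moreover have "\<forall>x\<in>insert y I. p (x - 1) < (\<phi>(y := i)) x \<and> (\<phi>(y := i)) x \<le> q x"
    using \<phi> i y by auto
  ultimately show ?thesis
    unfolding indeps_band_matroid using assms(3) y(1) by blast
qed

section \<open>Independent sets and ranks in a band\<close>

locale band =
  fixes n r :: nat and p q :: "nat \<Rightarrow> nat"
  assumes p: "unit_steps 0 n p" "p 0 = 0" "p n = r"
    and q: "unit_steps 0 n q" "q 0 = 0" "q n = r"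
    and p_le_q: "j \<le> n \<Longrightarrow> p j \<le> q j"
begin

abbreviation "M \<equiv> band_matroid n p q"

text \<open>By monotonicity of \<open>p\<close> and \<open>q\<close>, a matching of \<open>I\<close>
  takes its values above \<open>p u\<close> and up to \<open>q v\<close>.\<close>

lemma card_indep_interval_le:
  assumes I: "I \<in> indeps M" "I \<subseteq> {u<..v}" and "v \<le> n"
  shows "card I \<le> q v - p u"
proof -
  obtain \<phi> where \<phi>: "inj_on \<phi> I" "\<forall>x\<in>I. p (x - 1) < \<phi> x \<and> \<phi> x \<le> q x"
    using I(1) unfolding indeps_band_matroid by blast
  have "\<phi> ` I \<subseteq> {p u<..q v}"
  proof (rule image_subsetI)
    fix x assume "x \<in> I"
    then have x: "u < x" "x \<le> v" "p (x - 1) < \<phi> x" "\<phi> x \<le> q x" using I \<phi> by auto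
    then show "\<phi> x \<in> {p u<..q v}"
      using unit_steps_bounds(1)[OF p(1), of u "x - 1"] unit_steps_bounds(1)[OF q(1), of x v] \<open>v \<le> n\<close>
      by fastforce
  qed
  then have "card I \<le> card {p u<..q v}" using \<phi>(1) by (intro card_inj_on_le) auto
  then show ?thesis by simp
qed

text \<open>\<open>g\<close> itself is the matching: at a North step \<open>x\<close>,
  \<open>g x\<close> exceeds \<open>g (x - 1)\<close> and hence \<open>p (x - 1)\<close>.\<close>

lemma norths_indep:
  assumes g: "unit_steps u v g" and "v \<le> n"
    and pg: "\<And>j. u \<le> j \<Longrightarrow> j \<le> v \<Longrightarrow> p j \<le> g j" and gq: "\<And>j. u \<le> j \<Longrightarrow> j \<le> v \<Longrightarrow> g j \<le> q j"
  shows "norths g u v \<in> indeps M"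
proof -
  have "inj_on g (norths g u v)" by (rule inj_on_norths[OF g])
  moreover have "p (x - 1) < g x \<and> g x \<le> q x" if "x \<in> norths g u v" for x
    using that pg[of "x - 1"] gq[of x] unfolding norths_def by fastforce
  ultimately show ?thesis
    unfolding indeps_band_matroid using \<open>v \<le> n\<close> by (auto simp: norths_def)
qed

text \<open>The North steps of the highest path attain the bound of
  \<open>card_indep_interval_le\<close>.\<close>

lemma rank_prefix:
  assumes "h \<le> n" shows "rank_of M {0<..h} = q h"
proof (rule antisym)
  show "rank_of M {0<..h} \<le> q h"
    using card_indep_interval_le[of _ 0 h] assms by (intro rank_of_le) (auto simp: p)
  have "norths q 0 h \<in> indeps M"
    using assms p_le_q by (intro norths_indep unit_steps_subinterval[OF q(1)]) auto
  then have "card (norths q 0 h) \<le> rank_of M {0<..h}"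
    by (intro card_le_rank_of) (auto simp: norths_def)
  then show "q h \<le> rank_of M {0<..h}"
    using card_norths[of 0 h q] unit_steps_subinterval[OF q(1), of 0 h] assms q by simp
qed

lemma rank_suffix:
  assumes "h \<le> n" shows "rank_of M {h<..n} = r - p h"
proof (rule antisym)
  show "rank_of M {h<..n} \<le> r - p h"
    using card_indep_interval_le[of _ h n] assms by (intro rank_of_le) (auto simp: q)
  have "norths p h n \<in> indeps M"
    using assms p_le_q by (intro norths_indep unit_steps_subinterval[OF p(1)]) auto
  then have "card (norths p h n) \<le> rank_of M {h<..n}"
    by (intro card_le_rank_of) (auto simp: norths_def)
  then show "r - p h \<le> rank_of M {h<..n}"
    using card_norths[of h n p] unit_steps_subinterval[OF p(1), of h n] assms p by simp
qed

lemma rank_ground: "rank_of M {0<..n} = r"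
  using rank_prefix[of n] q by simp

section \<open>Uniform restrictions and a lower bound for rank sums\<close>

text \<open>The element \<open>x\<close> is matched with its rank in \<open>D\<close>, which differs from its rank in
  the whole \<open>(r + t)\<close>-element set by at most \<open>t\<close>.\<close>

lemma uniform_on:
  assumes g: "unit_steps 0 n g" "g 0 = 0" "g n = r"
    and pg: "\<And>j. j \<le> n \<Longrightarrow> p j \<le> g j"
    and gq: "\<And>j. j \<le> n \<Longrightarrow> g j + min t (min j (n - j)) \<le> q j"
    and t: "2 * t \<le> n"
  shows "card ({0<..t} \<union> norths g 0 n) = r + t"
    and "D \<subseteq> {0<..t} \<union> norths g 0 n \<Longrightarrow> card D \<le> r \<Longrightarrow> D \<in> indeps M"
proof -
  let ?C = "{0<..t} \<union> norths g 0 n"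
  \<comment> \<open>Since \<open>2 * t \<le> n\<close>, the hypothesis \<open>gq\<close> reads
    \<open>g j + j \<le> q j\<close> here, while \<open>q j \<le> j\<close>. So no North step of
    \<open>g\<close> is among the first \<open>t\<close> elements.\<close>
  have g_init: "g j = 0" if "j \<le> t" for j
    using gq[of j] unit_steps_bounds(2)[OF q(1), of 0 j] q(2) that t by simp
  have above: "t < x" if "x \<in> norths g 0 n" for x
    using that g_init[of x] unfolding norths_def by (force simp: not_less)
  have count: "card {y \<in> ?C. y \<le> x} = min x t + g x" if "x \<le> n" for x
  proof -
    have "{y \<in> ?C. y \<le> x} = {0<..min x t} \<union> norths g 0 x"
      using that unfolding norths_def by auto
    moreover have "{0<..min x t} \<inter> norths g 0 x = {}"
      using above that unfolding norths_def by force
    moreover have "g x = card (norths g 0 x)"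
      using card_norths[of 0 x g] unit_steps_subinterval[OF g(1), of 0 x] that g(2) by simp
    ultimately show ?thesis by (simp add: card_Un_disjoint)
  qed
  have "{y \<in> ?C. y \<le> n} = ?C" using t unfolding norths_def by auto
  then show cardC: "card ?C = r + t" using count[of n] g(3) t by simp
  have full: "D \<in> indeps M" if D: "D \<subseteq> ?C" "card D = r" for D
  proof -
    have finD: "finite D" by (rule finite_subset[OF D(1)]) simp
    let ?\<phi> = "\<lambda>x. card {y \<in> D. y \<le> x}"
    have "p (x - 1) < ?\<phi> x \<and> ?\<phi> x \<le> q x" if "x \<in> D" for x
    proof
      have x: "0 < x" "x \<le> n" using that D t unfolding norths_def by auto
      have le_r: "?\<phi> x \<le> r" unfolding D(2)[symmetric] using finD by (intro card_mono) auto
      have le: "?\<phi> x \<le> min x t + g x"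
        unfolding count[OF x(2), symmetric] using D by (intro card_mono) auto
      have "card (?C - D) = t" using D finD cardC by (simp add: card_Diff_subset)
      moreover have "{y \<in> ?C. y \<le> x} \<subseteq> {y \<in> D. y \<le> x} \<union> (?C - D)" by blast
      then have "card {y \<in> ?C. y \<le> x} \<le> card ({y \<in> D. y \<le> x} \<union> (?C - D))"
        using finD by (intro card_mono) auto
      then have "min x t + g x \<le> ?\<phi> x + card (?C - D)"
        using card_Un_le[of "{y \<in> D. y \<le> x}" "?C - D"] count[OF x(2)] by linarith
      ultimately have ge: "min x t + g x \<le> ?\<phi> x + t" by simp
      have pos: "0 < ?\<phi> x" using that finD by (auto simp: card_gt_0_iff)
      show "p (x - 1) < ?\<phi> x"
      proof (cases "x \<le> t")
        case True
        then show ?thesis using pg[of "x - 1"] g_init[of "x - 1"] pos x by simp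
      next
        case False
        then have "g x = Suc (g (x - 1))" using that D unfolding norths_def by auto
        moreover have "p (x - 1) \<le> g (x - 1)" using pg x by simp
        ultimately show ?thesis using ge False by linarith
      qed
      show "?\<phi> x \<le> q x"
      proof (cases "x \<le> n - t")
        case True
        then show ?thesis using le gq[OF x(2)] t x by simp
      next
        case False
        \<comment> \<open>Fewer than \<open>t\<close> steps remain after \<open>x\<close>, so
          \<open>gq\<close> gives \<open>g x + (n - x) \<le> q x\<close>, and \<open>g\<close>
          reaches \<open>r\<close> only if \<open>r \<le> g x + (n - x)\<close>.\<close>
        then have "r \<le> q x"
          using gq[OF x(2)] unit_steps_bounds(2)[OF g(1), of x n] g(3) x t by simp
        then show ?thesis using le_r by simp
      qed
    qed
    then show ?thesis
      unfolding indeps_band_matroid using inj_on_initial_count[OF finD] D t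
      by (auto simp: norths_def)
  qed
  show "D \<in> indeps M" if D: "D \<subseteq> ?C" "card D \<le> r"
  proof -
    obtain B where "D \<subseteq> B" "B \<subseteq> ?C" "card B = r"
      using exists_subset_between[of D r ?C] D cardC by auto
    then show ?thesis by (intro indeps_subset[OF is_matroid_band_matroid full])
  qed
qed

text \<open>This is the case of \<open>uniform_on\<close> with \<open>t\<close> equal to 1:
  \<open>r + 1\<close> elements carrying a uniform matroid of rank \<open>r\<close> form a
  circuit.\<close>

lemma spanning_circuit:
  assumes g: "unit_steps 0 n g" "g 0 = 0" "g n = r" and "2 \<le> n"
    and pg: "\<And>j. j \<le> n \<Longrightarrow> p j \<le> g j"
    and gq: "\<And>j. 0 < j \<Longrightarrow> j < n \<Longrightarrow> g j < q j"
  shows "circuit M (insert 1 (norths g 0 n))" "spanning M (insert 1 (norths g 0 n))"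
proof -
  let ?C = "insert 1 (norths g 0 n)"
  have *: "{0<..1} \<union> norths g 0 n = ?C" by auto
  have gq': "g j + min 1 (min j (n - j)) \<le> q j" if "j \<le> n" for j
    using gq[of j] that g(2,3) q(2,3) by (cases "j = 0 \<or> j = n") auto
  have C: "?C \<subseteq> {0<..n}" using \<open>2 \<le> n\<close> unfolding norths_def by auto
  note U = uniform_on[OF g pg gq', simplified *]
  have card: "card ?C = r + 1" using U(1) \<open>2 \<le> n\<close> by simp
  have indep: "D \<in> indeps M" if "D \<subset> ?C" for D
    using U(2)[of D] \<open>2 \<le> n\<close> psubset_card_mono[OF _ that] that card by simp
  have "?C \<notin> indeps M"
    using card_le_rank_of[OF is_matroid_band_matroid _ C] card rank_ground by fastforce
  then show "circuit M ?C" unfolding circuit_def using C indep by simp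
  have "norths g 0 n \<noteq> ?C" using card card_norths[OF g(1)] g(2,3) by fastforce
  then have "norths g 0 n \<in> indeps M" using indep by blast
  then have "r \<le> rank_of M ?C"
    using card_le_rank_of[OF is_matroid_band_matroid, of "norths g 0 n" n p q ?C] card_norths[OF g(1)] g(2,3) by auto
  moreover have "rank_of M ?C \<le> r"
    using card_indep_interval_le[of _ 0 n] C p(2) q(3) by (intro rank_of_le) (simp_all add: subset_trans)
  ultimately show "spanning M ?C" unfolding spanning_def using C rank_ground by simp
qed

text \<open>Either \<open>X\<close> and \<open>Y\<close> both meet \<open>?C\<close> in at most
  \<open>r\<close> elements, and these independent sets have \<open>r + t\<close> elements together;
  or one side contains \<open>r\<close> elements of \<open>?C\<close>, and the other has rank at
  least \<open>t\<close> by its size.\<close>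

lemma rank_sum_ge:
  assumes d: "\<And>j. j \<le> n \<Longrightarrow> p j + min t (min j (n - j)) \<le> q j"
    and XY: "X \<union> Y = {0<..n}" "X \<inter> Y = {}" "t \<le> card X" "t \<le> card Y"
  shows "r + t \<le> rank_of M X + rank_of M Y"
proof -
  let ?C = "{0<..t} \<union> norths p 0 n"
  have fin: "finite X" "finite Y" using XY(1) by (metis finite_Un finite_greaterThanAtMost)+
  have "card X + card Y = n" using card_Un_disjoint[OF fin XY(2)] XY(1) by simp
  then have t: "2 * t \<le> n" using XY by simp
  note U = uniform_on[OF p _ d t]
  have cardC: "card ?C = r + t" using U(1) by simp
  have indep: "D \<in> indeps M" if "D \<subseteq> ?C" "card D \<le> r" for D using U(2)[of D] that by simp
  have "t \<le> r" using d[of t] unit_steps_bounds(1)[OF q(1), of t n] q(3) t by simp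
  have small: "t \<le> rank_of M Z" if Z: "Z \<subseteq> {0<..n}" "t \<le> card Z" for Z
  proof -
    obtain T where T: "T \<subseteq> Z" "card T = t" "finite T"
      using obtain_subset_with_card_n[OF Z(2)] by blast
    \<comment> \<open>The part of \<open>T\<close> inside \<open>?C\<close> is independent by
      uniformity; the remaining elements, all East steps of \<open>p\<close>, are added one at a
      time.\<close>
    have "(T \<inter> ?C) \<union> W \<in> indeps M" if "W \<subseteq> T - ?C" for W
      using finite_subset[OF that finite_Diff[OF T(3)]] that
    proof (induction W rule: finite_induct)
      case empty
      have "card (T \<inter> ?C) \<le> t" using T by (metis card_mono inf_le1)
      then show ?case using indep[of "T \<inter> ?C"] \<open>t \<le> r\<close> by simp
    next
      case (insert y W)
      let ?V = "(T \<inter> ?C) \<union> W"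
      obtain \<phi> where V: "?V \<subseteq> {0<..n}" and \<phi>: "inj_on \<phi> ?V" "\<forall>x\<in>?V. p (x - 1) < \<phi> x \<and> \<phi> x \<le> q x"
        using insert unfolding indeps_band_matroid by blast
      have yT: "y \<in> T" "y \<notin> ?C" using insert.prems by auto
      then have y: "t < y" "y \<le> n" "p y \<noteq> Suc (p (y - 1))" using T(1) Z(1) unfolding norths_def by auto
      then have py: "p y = p (y - 1)" using unit_stepsD[OF p(1), of "y - 1"] by auto
      \<comment> \<open>Near the end, the gap before step \<open>y\<close> forces \<open>p\<close>
        to be at least as many steps below \<open>r\<close> as remain, so an East step at
        \<open>y\<close> would leave \<open>p\<close> unable to reach \<open>r\<close>.\<close>
      have yn: "y \<le> n - t"
      proof (rule ccontr)
        assume "\<not> y \<le> n - t"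
        then have "min t (min (y - 1) (n - (y - 1))) = n - (y - 1)" using y t by linarith
        then have "p (y - 1) + (n - (y - 1)) \<le> q (y - 1)" using d[of "y - 1"] y by simp
        moreover have "q (y - 1) \<le> r" using unit_steps_bounds(1)[OF q(1), of "y - 1" n] y q(3) by simp
        moreover have "r \<le> p y + (n - y)" using unit_steps_bounds(2)[OF p(1), of y n] y p(3) by simp
        ultimately show False using py y by simp
      qed
      have qy: "p y + t \<le> q y" using d[OF y(2)] y yn by simp
      \<comment> \<open>The \<open>t\<close> indices after \<open>p y\<close> are all admissible for
        \<open>y\<close>, and the fewer than \<open>t\<close> elements already matched leave one of
        them free.\<close>
      have "card ?V < card T" using T(3) yT insert by (intro psubset_card_mono) auto
      then have "card (\<phi> ` ?V) < card {p y<..p y + t}"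
        using T(2) \<phi>(1) by (simp add: card_image)
      then have "\<not> {p y<..p y + t} \<subseteq> \<phi> ` ?V"
        using V finite_subset by (metis card_mono finite_greaterThanAtMost finite_imageI not_le)
      then obtain i where i: "p y < i" "i \<le> p y + t" "i \<notin> \<phi> ` ?V"
        by (metis greaterThanAtMost_iff subsetI)
      have "y \<notin> ?V" using yT insert by auto
      have "insert y ?V \<in> indeps M"
        by (rule insert_indep_band_matroid[OF \<phi>(1) _ V _ \<open>y \<notin> ?V\<close>, where i = i]) (use \<phi> i y py qy in auto)
      then show ?case by simp
    qed
    from this[of "T - ?C"] have "T \<in> indeps M" by (simp add: Int_Diff_Un)
    then show ?thesis using card_le_rank_of[of M T Z] T by simp
  qed
  have big: "card (Z \<inter> ?C) \<le> rank_of M Z" if "card (Z \<inter> ?C) \<le> r" for Z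
    using card_le_rank_of[of M "Z \<inter> ?C" Z] indep that by simp
  have huge: "r \<le> rank_of M Z" if Z: "r \<le> card (Z \<inter> ?C)" for Z
  proof -
    obtain B where B: "B \<subseteq> Z \<inter> ?C" "card B = r"  using obtain_subset_with_card_n[OF Z] by blast
    then show ?thesis using card_le_rank_of[of M B Z] indep[of B] by simp
  qed
  have "?C \<subseteq> {0<..n}" using t unfolding norths_def by auto
  then have "?C = (X \<inter> ?C) \<union> (Y \<inter> ?C)" using XY(1) by blast
  then have "card ?C = card (X \<inter> ?C) + card (Y \<inter> ?C)"
    using card_Un_disjoint[of "X \<inter> ?C" "Y \<inter> ?C"] XY(2) fin by auto
  then have sum: "r + t = card (X \<inter> ?C) + card (Y \<inter> ?C)" using cardC by simp
  have t_le: "t \<le> rank_of M X" "t \<le> rank_of M Y" using small XY by auto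
  consider "card (X \<inter> ?C) \<le> r" "card (Y \<inter> ?C) \<le> r" | "r \<le> card (X \<inter> ?C)" | "r \<le> card (Y \<inter> ?C)"
    by linarith
  then show ?thesis
  proof cases
    case 1
    then show ?thesis using sum big[of X] big[of Y] by linarith
  next
    case 2
    then show ?thesis using t_le huge[of X] by linarith
  next
    case 3
    then show ?thesis using t_le huge[of Y] by linarith
  qed
qed

section \<open>Connectivity of intervals and the gap in a connected band\<close>

text \<open>For \<open>x < y\<close> the function \<open>f\<close> follows \<open>lo\<close> between \<open>x\<close> and \<open>y\<close>, with an East step at \<open>x\<close> and
  a North step at \<open>y\<close>; lifting it by one on that stretch exchanges \<open>y\<close> for \<open>x\<close> in the basis.\<close>

lemma matroid_connected_interval:
  assumes "v \<le> n"
    and lo: "unit_steps u v lo" and hi: "unit_steps u v hi"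
    and ends: "lo u = hi u" "lo v = hi v"
    and less: "\<And>j. u < j \<Longrightarrow> j < v \<Longrightarrow> lo j < hi j"
    and p_lo: "\<And>j. u \<le> j \<Longrightarrow> j \<le> v \<Longrightarrow> p j \<le> lo j"
    and hi_q: "\<And>j. u \<le> j \<Longrightarrow> j \<le> v \<Longrightarrow> hi j \<le> q j"
    and rank: "q v - p u \<le> lo v - lo u"
  shows "matroid_connected (restriction M {u<..v})"
proof -
  have through: "\<exists>C. circuit M C \<and> C \<subseteq> {u<..v} \<and> x \<in> C \<and> y \<in> C"
    if xy: "u < x" "x < y" "y \<le> v" for x y
  proof -
    \<comment> \<open>Before \<open>x\<close>, \<open>f\<close> is \<open>hi\<close> capped at
      \<open>lo x\<close>; the cap is reached by \<open>x - 1\<close>, so step \<open>x\<close> is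
      East. From \<open>y\<close> on it is \<open>lo\<close> raised to at least
      \<open>Suc (lo (y - 1))\<close>, so step \<open>y\<close> is North.\<close>
    define f where "f j = (if j < x then min (hi j) (lo x) else if j < y then lo j
      else max (lo j) (Suc (lo (y - 1))))" for j
    define g where "g j = (if x \<le> j \<and> j < y then Suc (lo j) else f j)" for j
    have le: "lo j \<le> hi j" if "u \<le> j" "j \<le> v" for j
      using that less[of j] ends by (cases "j = u \<or> j = v") auto
    have lo_x: "lo x \<le> hi (x - 1)"
      using less[of x] unit_steps_pred[OF hi, of x] xy by auto
    have hi_y: "Suc (lo (y - 1)) \<le> hi j" if "y \<le> j" "j \<le> v" for j
      using less[of "y - 1"] unit_steps_bounds(1)[OF hi, of "y - 1" j] xy that by fastforce
    have steps: "(f (Suc j) = f j \<or> f (Suc j) = Suc (f j)) \<and> (g (Suc j) = g j \<or> g (Suc j) = Suc (g j)) \<and>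
        (Suc j \<in> norths g u v \<longleftrightarrow> Suc j = x \<or> Suc j \<in> norths f u v \<and> Suc j \<noteq> y)"
      if j: "u \<le> j" "j < v" for j
    proof -
      note lo_j = unit_stepsD[OF lo j] and hi_j = unit_stepsD[OF hi j]
      consider "Suc j < x" | "Suc j = x" | "x \<le> j" "Suc j < y" | "x \<le> j" "Suc j = y" | "y \<le> j"
        by linarith
      then show ?thesis
      proof cases
        case 1
        then show ?thesis using hi_j xy by (auto simp: f_def g_def norths_def)
      next
        case 2
        then show ?thesis using lo_x xy j by (auto simp: f_def g_def norths_def)
      next
        case 3
        then show ?thesis using lo_j xy j by (auto simp: f_def g_def norths_def)
      next
        case 4
        then show ?thesis using lo_j xy j by (auto simp: f_def g_def norths_def)
      next
        case 5
        then show ?thesis using lo_j xy by (auto simp: f_def g_def norths_def)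
      qed
    qed
    have band: "p j \<le> f j \<and> p j \<le> g j \<and> f j \<le> q j \<and> g j \<le> q j" if "u \<le> j" "j \<le> v" for j
    proof -
      have "lo j \<le> f j" "lo j \<le> g j"
        using le[of j] unit_steps_bounds(1)[OF lo, of j x] that xy by (auto simp: f_def g_def)
      moreover have "f j \<le> hi j"
        using le[of j] hi_y[of j] that xy by (auto simp: f_def)
      moreover have "g j \<le> hi j"
        using calculation(3) less[of j] that xy by (auto simp: g_def)
      ultimately show ?thesis using p_lo[OF that] hi_q[OF that] by linarith
    qed
    have f: "unit_steps u v f" and g: "unit_steps u v g"
      using steps unfolding unit_steps_def by blast+
    have indep: "norths f u v \<in> indeps M" "norths g u v \<in> indeps M"
      using band by (auto intro!: norths_indep f g \<open>v \<le> n\<close>)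
    have sub: "norths h u v \<subseteq> {u<..v}" for h unfolding norths_def by auto
    have x: "x \<notin> norths f u v" using lo_x xy by (auto simp: f_def norths_def)
    have "f y = Suc (f (y - 1))"
      using unit_steps_pred[OF lo, of y] xy by (auto simp: f_def)
    then have y: "y \<in> norths f u v" using xy by (simp add: norths_def)
    let ?A = "norths f u v - {y}"
    have "norths g u v = insert x ?A"
    proof (rule set_eqI)
      fix j
      show "j \<in> norths g u v \<longleftrightarrow> j \<in> insert x ?A"
      proof (cases "j \<in> {u<..v}")
        case True
        then show ?thesis using steps[of "j - 1"] xy by fastforce
      next
        case False
        then show ?thesis using sub xy by fastforce
      qed
    qed
    then have "insert x ?A \<in> indeps M" "insert y ?A \<in> indeps M"
      using indep y by (simp_all add: insert_absorb)
    moreover have "insert x (insert y ?A) \<notin> indeps M"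
    proof
      \<comment> \<open>\<open>norths f u v\<close> has \<open>lo v - lo u\<close> elements, by
        \<open>rank\<close> already the maximum for an independent subset of the interval;
        \<open>x\<close> is one too many.\<close>
      assume ind: "insert x (insert y ?A) \<in> indeps M"
      have "f u = lo u" using unit_steps_bounds(1)[OF lo, of u x] ends xy by (simp add: f_def)
      moreover have "f v = lo v" using hi_y[of v] ends xy by (simp add: f_def)
      ultimately have "lo v = lo u + card (norths f u v)" using card_norths[OF f] xy by simp
      moreover have "insert x (insert y ?A) = insert x (norths f u v)" using y by auto
      ultimately have "card (insert x (insert y ?A)) = Suc (lo v - lo u)" using x by simp
      moreover have "insert x (insert y ?A) \<subseteq> {u<..v}" using sub xy by auto
      ultimately show False
        using card_indep_interval_le[OF ind _ \<open>v \<le> n\<close>, of u] rank by simp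
    qed
    ultimately obtain C where "circuit M C" "x \<in> C" "y \<in> C" "C \<subseteq> insert x (insert y ?A)"
      using circuit_through_exchanged_pair[OF is_matroid_band_matroid] by metis
    moreover have "insert x (insert y ?A) \<subseteq> {u<..v}" using sub xy by auto
    ultimately show ?thesis by blast
  qed
  show ?thesis
    unfolding matroid_connected_def circuit_restriction_iff
  proof (intro ballI impI)
    fix x y assume "x \<in> ground (restriction M {u<..v})" "y \<in> ground (restriction M {u<..v})" "x \<noteq> y"
    then show "\<exists>C. (circuit M C \<and> C \<subseteq> {u<..v}) \<and> x \<in> C \<and> y \<in> C"
      using through[of x y] through[of y x] unfolding restriction_def
      by (cases "x < y") auto
  qed
qed

text \<open>If the paths meet at \<open>j\<close>, elements up to \<open>j\<close> use indices up to
  \<open>q j\<close> and later elements use larger ones. Matchings of the two proper parts of a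
  circuit through \<open>j\<close> and \<open>j + 1\<close> would then combine to a matching of the
  circuit.\<close>

lemma connected_gap:
  assumes "matroid_connected M" "0 < j" "j < n"
  shows "p j < q j"
proof (rule ccontr)
  assume "\<not> p j < q j"
  then have pq: "p j = q j" using p_le_q[of j] assms by simp
  obtain C where C: "circuit M C" "j \<in> C" "Suc j \<in> C"
    using assms(1)[unfolded matroid_connected_def, rule_format, of j "Suc j"] assms by auto
  have "C \<inter> {..j} \<subset> C" "C \<inter> {j<..} \<subset> C" using C(2,3) by force+
  then have "C \<inter> {..j} \<in> indeps M" "C \<inter> {j<..} \<in> indeps M"
    using C(1) unfolding circuit_def by blast+
  then obtain \<phi> \<psi> where \<phi>: "inj_on \<phi> (C \<inter> {..j})" "\<forall>x\<in>C \<inter> {..j}. p (x - 1) < \<phi> x \<and> \<phi> x \<le> q x"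
    and \<psi>: "inj_on \<psi> (C \<inter> {j<..})" "\<forall>x\<in>C \<inter> {j<..}. p (x - 1) < \<psi> x \<and> \<psi> x \<le> q x"
    unfolding indeps_band_matroid by blast
  have sub: "C \<subseteq> {0<..n}" using C unfolding circuit_def by simp
  have low: "\<phi> x \<le> q j" if "x \<in> C" "x \<le> j" for x
    using bspec[OF \<phi>(2), of x] that unit_steps_bounds(1)[OF q(1), of x j] assms by simp
  have high: "q j < \<psi> x" if "x \<in> C" "j < x" for x
  proof -
    have "p j \<le> p (x - 1)" using unit_steps_bounds(1)[OF p(1), of j "x - 1"] that sub by fastforce
    moreover have "p (x - 1) < \<psi> x" using \<psi>(2) that by simp
    ultimately show ?thesis using pq by simp
  qed
  let ?\<chi> = "\<lambda>x. if x \<le> j then \<phi> x else \<psi> x"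
  have "inj_on ?\<chi> C"
  proof (rule inj_onI)
    fix x y assume "x \<in> C" "y \<in> C" "?\<chi> x = ?\<chi> y"
    then show "x = y"
      using low[of x] low[of y] high[of x] high[of y] inj_onD[OF \<phi>(1), of x y] inj_onD[OF \<psi>(1), of x y]
      by (auto split: if_splits)
  qed
  moreover have "\<forall>x\<in>C. p (x - 1) < ?\<chi> x \<and> ?\<chi> x \<le> q x" using \<phi>(2) \<psi>(2) by auto
  ultimately have "C \<in> indeps M" unfolding indeps_band_matroid using sub by blast
  then show False using C(1) unfolding circuit_def by blast
qed

section \<open>Corners\<close>

text \<open>A corner is recorded by its point \<open>h\<close> on the path. An EN corner of the
  upper path at \<open>h\<close> belongs to the element \<open>h + 1\<close>, and with this indexing
  both kinds satisfy the same formula: the incidence count is one more than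
  \<open>q h - p h\<close>.\<close>

definition corners :: "nat set" where
  "corners = {h. 1 \<le> h \<and> h < n \<and>
     (p h = Suc (p (h - 1)) \<and> p (Suc h) = p h \<or> q h = q (h - 1) \<and> q (Suc h) = Suc (q h))}"

lemma path_bounds:
  assumes "j \<le> n"
  shows "q j \<le> j" "q j \<le> r" "r \<le> p j + (n - j)" "p j \<le> r" "r \<le> q j + (n - j)"
  using unit_steps_bounds[OF q(1), of 0 j] unit_steps_bounds[OF q(1), of j n]
    unit_steps_bounds[OF p(1), of j n] assms p q by auto

text \<open>If the gap at \<open>j\<close> were too small, \<open>p\<close> would have a North step before and an East step after \<open>j\<close>, or
  \<open>q\<close> the reverse, and the nearby corner would have a gap at most that at \<open>j\<close>; in the two remaining
  cases the gap at \<open>j\<close> is \<open>r\<close> or \<open>n - r\<close>, the largest possible.\<close>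

lemma gap_ge:
  assumes c: "c \<in> corners" and K: "\<And>h. h \<in> corners \<Longrightarrow> K \<le> q h - p h" and j: "j \<le> n"
  shows "p j + min K (min j (n - j)) \<le> q j"
proof (rule ccontr)
  assume "\<not> ?thesis"
  then have lt: "q j < p j + K" "q j < p j + j" "q j < p j + (n - j)" by auto
  have pq: "p j \<le> q j" using p_le_q j .
  have smaller: False if "h \<in> corners" "q h - p h \<le> q j - p j" for h
    using K[OF that(1)] that(2) lt(1) pq by linarith
  \<comment> \<open>\<open>c\<close> exhibits a gap larger than that at \<open>j\<close>; the final
    cases refute this, since no gap exceeds \<open>r\<close> or \<open>n - r\<close>.\<close>
  have larger: "q j - p j < q c - p c" using smaller[OF c] not_le by blast
  have A: "p j = 0 \<or> p j + (n - j) \<le> r"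
  proof (rule ccontr)
    assume "\<not> ?thesis"
    then have "0 < p j" "p n < p j + (n - j)" using p(3) by auto
    then obtain h where h: "1 \<le> h" "h < n" "p h = Suc (p (h - 1))" "p (Suc h) = p h"
      "(h \<le> j \<and> p h = p j) \<or> (j \<le> h \<and> p h = p j + (h - j))"
      using corner_near[OF p(1,2), of j] j by metis
    \<comment> \<open>Going from \<open>j\<close> back to \<open>h\<close>, \<open>p\<close> stays
      level and \<open>q\<close> cannot rise; going forward, \<open>p\<close> climbs at every step
      and \<open>q\<close> cannot climb faster.\<close>
    have "q h - p h \<le> q j - p j"
      using h(2,5) unit_steps_bounds(1)[OF q(1), of h j] unit_steps_bounds(2)[OF q(1), of j h] j by auto
    then show False using smaller h unfolding corners_def by blast
  qed
  have B: "q j = j \<or> q j = r"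
  proof (rule ccontr)
    assume "\<not> ?thesis"
    then have "q j < j" "q j < q n" using path_bounds[OF j] q(3) by auto
    then obtain h where h: "1 \<le> h" "h < n" "q h = q (h - 1)" "q (Suc h) = Suc (q h)"
      "(h \<le> j \<and> q j = q h + (j - h)) \<or> (j \<le> h \<and> q h = q j)"
      using valley_near[OF q(1,2) j] by metis
    have "q h - p h \<le> q j - p j"
      using h(2,5) unit_steps_bounds(2)[OF p(1), of h j] unit_steps_bounds(1)[OF p(1), of j h] j by auto
    then show False using smaller h unfolding corners_def by blast
  qed
  have "c \<le> n" using c unfolding corners_def by simp
  note bc = path_bounds[OF this]
  show False
  proof (cases "p j = 0")
    case True
    then have "q j = r" using B lt by simp
    then show False using larger bc True by linarith
  next
    case False
    then have "p j + (n - j) \<le> r" using A by simp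
    moreover from this have "q j = j" using B lt by simp
    ultimately show False using larger bc \<open>c \<le> n\<close> j by linarith
  qed
qed

text \<open>Without corners the lower path makes all its East steps first and the upper path all its
  North steps first (\<open>A\<close> and \<open>B\<close>), so every \<open>r\<close>-element set
  can be matched in increasing order.\<close>

lemma uniform_if_no_corners:
  assumes "corners = {}"
  shows "uniform M"
proof -
  have A: "p j = 0 \<or> p j + (n - j) \<le> r" if j: "j \<le> n" for j
  proof (rule ccontr)
    assume "\<not> ?thesis"
    then have "0 < p j" "p n < p j + (n - j)" using p(3) by auto
    then obtain h where "1 \<le> h" "h < n" "p h = Suc (p (h - 1))" "p (Suc h) = p h"
      using corner_near[OF p(1,2), of j] j by metis
    then show False using assms unfolding corners_def by blast
  qed
  have B: "q j = j \<or> q j = r" if j: "j \<le> n" for j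
  proof (rule ccontr)
    assume "\<not> ?thesis"
    then have "q j < j" "q j < q n" using path_bounds[OF j] q(3) by auto
    then obtain h where "1 \<le> h" "h < n" "q h = q (h - 1)" "q (Suc h) = Suc (q h)"
      using valley_near[OF q(1,2) j] by metis
    then show False using assms unfolding corners_def by blast
  qed
  have full: "D \<in> indeps M" if D: "D \<subseteq> {0<..n}" "card D = r" for D
  proof -
    have fin: "finite D" using D finite_subset by blast
    let ?\<phi> = "\<lambda>x. card {y \<in> D. y \<le> x}"
    have "p (x - 1) < ?\<phi> x \<and> ?\<phi> x \<le> q x" if "x \<in> D" for x
    proof
      have x: "0 < x" "x \<le> n" using that D by auto
      have "?\<phi> x \<le> card {0<..x}" using D by (intro card_mono) auto
      moreover have "?\<phi> x \<le> r" unfolding D(2)[symmetric] using fin by (intro card_mono) auto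
      ultimately show "?\<phi> x \<le> q x" using B[OF x(2)] by auto
      have pos: "0 < ?\<phi> x" using that fin by (auto simp: card_gt_0_iff)
      have "card D \<le> card ({y \<in> D. y \<le> x} \<union> {x<..n})" using D fin by (intro card_mono) auto
      then have "r \<le> ?\<phi> x + (n - x)" using card_Un_le[of "{y \<in> D. y \<le> x}" "{x<..n}"] D(2) by simp
      moreover have "p (x - 1) = 0 \<or> p (x - 1) + (n - (x - 1)) \<le> r"
        by (rule A) (use x in simp)
      ultimately show "p (x - 1) < ?\<phi> x" using pos x by linarith
    qed
    then show ?thesis
      unfolding indeps_band_matroid using D(1) inj_on_initial_count[OF fin] by blast
  qed
  have "X \<in> indeps M \<longleftrightarrow> X \<subseteq> {0<..n} \<and> card X \<le> r" for X
  proof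
    assume X: "X \<in> indeps M"
    then have "X \<subseteq> {0<..n}" unfolding indeps_band_matroid by blast
    then show "X \<subseteq> {0<..n} \<and> card X \<le> r" using card_indep_interval_le[OF X, of 0 n] p q by simp
  next
    assume X: "X \<subseteq> {0<..n} \<and> card X \<le> r"
    have "r \<le> n" using path_bounds[of n] q(3) by simp
    then obtain D where "X \<subseteq> D" "D \<subseteq> {0<..n}" "card D = r"
      using exists_subset_between[of X r "{0<..n}"] X by auto
    then show "X \<in> indeps M" by (intro indeps_subset[OF is_matroid_band_matroid full])
  qed
  then show ?thesis unfolding uniform_def by auto
qed

text \<open>The ranks are those of a prefix and a suffix. The corner makes both sides large enough:
  each of its two steps improves one of the general bounds \<open>h\<close> and \<open>n - h\<close>
  on the gap by one.\<close>

lemma corner_exact_separation: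
  assumes h: "h \<in> corners"
  shows "exact_separation M (Suc (q h - p h)) {0<..h} {h<..n}"
proof -
  have hn: "1 \<le> h" "h < n" using h unfolding corners_def by auto
  have pq: "p h \<le> q h" using p_le_q[of h] hn by simp
  have "Suc (q h - p h) \<le> h \<and> Suc (q h - p h) \<le> n - h"
  proof -
    have b: "q h \<le> h" "q (h - 1) \<le> h - 1" "q h \<le> r" "q (Suc h) \<le> r"
      "r \<le> p h + (n - h)" "r \<le> p (Suc h) + (n - Suc h)"
      using path_bounds hn by simp_all
    consider "p h = Suc (p (h - 1))" "p (Suc h) = p h" | "q h = q (h - 1)" "q (Suc h) = Suc (q h)"
      using h unfolding corners_def by blast
    then show ?thesis using b pq hn by cases linarith+
  qed
  moreover have "{0<..h} \<union> {h<..n} = {0<..n}" using hn by auto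
  moreover have "q h + (r - p h) = r + Suc (q h - p h) - 1"
    using pq path_bounds[of h] hn by simp
  ultimately show ?thesis
    unfolding exact_separation_def separation_def
    using hn rank_prefix[of h] rank_suffix[of h] rank_ground by auto
qed

text \<open>If \<open>t < k\<close>, every corner has gap at least \<open>t\<close>, so
  \<open>gap_ge\<close> with \<open>t\<close> for \<open>K\<close> feeds \<open>rank_sum_ge\<close>,
  whose bound exceeds what a \<open>t\<close>-separation permits.\<close>

lemma separation_ge:
  assumes "c \<in> corners" and K: "\<And>h. h \<in> corners \<Longrightarrow> k \<le> Suc (q h - p h)"
    and sep: "separation M t X Y"
  shows "k \<le> t"
proof (rule ccontr)
  assume "\<not> k \<le> t"
  then have "t \<le> q h - p h" if "h \<in> corners" for h using K[OF that] by simp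
  then have "p j + min t (min j (n - j)) \<le> q j" if "j \<le> n" for j
    using gap_ge[OF assms(1) _ that] by blast
  then have "r + t \<le> rank_of M X + rank_of M Y"
    using sep unfolding separation_def by (intro rank_sum_ge) auto
  then show False using sep rank_ground unfolding separation_def ground_band_matroid by linarith
qed

end

section \<open>Fundamental flats at corners\<close>

locale connected_band = band +
  assumes gap: "0 < j \<Longrightarrow> j < n \<Longrightarrow> p j < q j"
begin

text \<open>The North step after \<open>h\<close> makes the prefix a proper flat: a later
  \<open>e\<close> can be matched with \<open>q e\<close>, above all indices used by the North steps
  of \<open>q\<close> in the prefix. The East step at \<open>h\<close> makes it connected.\<close>

lemma fundamental_flat_prefix:
  assumes h: "1 \<le> h" "h < n" and E: "q h = q (h - 1)" and N: "q (Suc h) = Suc (q h)"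
  shows "fundamental_flat M {0<..h}"
proof -
  have "q 1 \<noteq> 0" using gap[of 1] h by simp
  \<comment> \<open>The first step of \<open>q\<close> is North, so the East step at
    \<open>h\<close> comes later and the prefix has at least two elements.\<close>
  then have h2: "2 \<le> h" using E h q(2) by (cases "h = 1") auto
  have "Suc (q h) \<le> rank_of M (insert e {0<..h})" if e: "h < e" "e \<le> n" for e
  proof -
    have up: "q x \<le> q h" if "x \<in> norths q 0 h" for x
      using that unit_steps_bounds(1)[OF q(1), of x h] h by (simp add: norths_def)
    have "q h < q e" using unit_steps_bounds(1)[OF q(1), of "Suc h" e] N e by simp
    have "e - 1 < n" "0 < e - 1" using e h by auto
    then have pe: "p (e - 1) < q e"
      using gap[of "e - 1"] unit_steps_bounds(1)[OF q(1), of "e - 1" e] e by fastforce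
    have inj: "inj_on q (norths q 0 h)"
      using unit_steps_subinterval[OF q(1)] h by (intro inj_on_norths) simp
    have "p (x - 1) < q x" if "x \<in> norths q 0 h" for x
      using that p_le_q[of "x - 1"] h unfolding norths_def by fastforce
    moreover have "norths q 0 h \<subseteq> {0<..n}" "e \<notin> norths q 0 h" using h e by (auto simp: norths_def)
    moreover have "q e \<notin> q ` norths q 0 h" using up \<open>q h < q e\<close> by fastforce
    ultimately have "insert e (norths q 0 h) \<in> indeps M"
      using e pe by (intro insert_indep_band_matroid[OF inj, where i = "q e"]) auto
    then have "card (insert e (norths q 0 h)) \<le> rank_of M (insert e {0<..h})"
      by (intro card_le_rank_of) (auto simp: norths_def)
    moreover have "e \<notin> norths q 0 h" using e by (simp add: norths_def)
    ultimately show ?thesis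
      using card_norths[of 0 h q] unit_steps_subinterval[OF q(1), of 0 h] h q(2) by simp
  qed
  then have flat: "flat M {0<..h}"
    unfolding flat_def using rank_prefix[of h] h by (auto simp: Suc_le_eq)
  have conn: "matroid_connected (restriction M {0<..h})"
  proof (rule matroid_connected_interval)
    \<comment> \<open>This is the lowest path in the band with height \<open>q h\<close> at
      \<open>h\<close>: it follows \<open>p\<close> and then runs North. Truncated subtraction
      yields 0 where the run would be below the axis. As \<open>q\<close> has an East step at
      \<open>h\<close>, the run stays strictly below \<open>q\<close> before
      \<open>h\<close>.\<close>
    let ?lo = "\<lambda>j. max (p j) (q h + j - h)"
    have "?lo (Suc j) = ?lo j \<or> ?lo (Suc j) = Suc (?lo j)" if "j < h" for j
      using unit_stepsD[OF p(1), of j] that h by (auto simp: max_def)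
    then show "unit_steps 0 h ?lo" unfolding unit_steps_def by blast
    show "unit_steps 0 h q" using unit_steps_subinterval[OF q(1)] h by simp
    show "?lo 0 = q 0" using p q path_bounds[of h] h by simp
    show "?lo h = q h" using p_le_q[of h] h by simp
    show "?lo j < q j" if "0 < j" "j < h" for j
    proof -
      have "q (h - 1) \<le> q j + (h - 1 - j)"
        using unit_steps_bounds(2)[OF q(1), of j "h - 1"] that h by simp
      then show ?thesis using gap[of j] that h E by simp
    qed
    show "?lo j \<ge> p j" for j by simp
    show "q j \<le> q j" for j ..
    show "q h - p 0 \<le> ?lo h - ?lo 0" using p path_bounds[of h] h by simp
  qed (use h in simp)
  have lt: "rank_of M {0<..h} < matroid_rank M"
    using rank_prefix[of h] rank_ground N path_bounds[of "Suc h"] h by simp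
  \<comment> \<open>The spanning circuit below is the North steps of \<open>q\<close> together with \<open>n\<close>.\<close>
  define g where "g j = (if j = n then r else q j - 1)" for j
  have q_last: "q (n - 1) = r" "0 < r"
    using gap[of "n - 1"] path_bounds[of "n - 1"] h by auto
  \<comment> \<open>At \<open>j = 0\<close> truncated subtraction keeps \<open>g 0 = 0\<close>, so
    the initial North step of \<open>q\<close> turns into an East step; the lost unit is regained by
    a North step at \<open>n\<close>.\<close>
  have "g (Suc j) = g j \<or> g (Suc j) = Suc (g j)" if "j < n" for j
  proof (cases "Suc j = n")
    case True
    then show ?thesis using q_last by (auto simp: g_def)
  next
    case False
    then show ?thesis using unit_stepsD[OF q(1), of j] that gap[of j] q(2)
      by (cases "j = 0") (auto simp: g_def)
  qed
  then have g: "unit_steps 0 n g" unfolding unit_steps_def by blast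
  have g0: "g 0 = 0" "g n = r" using h q(2) by (auto simp: g_def)
  have "p j \<le> g j" if "j \<le> n" for j
    using gap[of j] p that by (cases "j = 0 \<or> j = n") (auto simp: g_def)
  moreover have "g j < q j" if "0 < j" "j < n" for j
    using gap[of j] that by (auto simp: g_def)
  ultimately have C: "circuit M (insert 1 (norths g 0 n))" "spanning M (insert 1 (norths g 0 n))"
    using spanning_circuit[OF g g0] h by simp_all
  have g1: "g 1 = 0" using path_bounds[of 1] h by (simp add: g_def)
  \<comment> \<open>The circuit meets the prefix in 1 and the \<open>q h - 1\<close> North steps of
    \<open>g\<close> up to \<open>h\<close>, which is \<open>q h\<close> elements in all.\<close>
  have "{0<..h} \<inter> insert 1 (norths g 0 n) = insert 1 (norths g 0 h)"
    using h by (auto simp: norths_def)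
  moreover have "1 \<notin> norths g 0 h" using g1 by (simp add: norths_def)
  moreover have "g h = card (norths g 0 h)"
    using card_norths[of 0 h g] unit_steps_subinterval[OF g, of 0 h] g0 h by simp
  moreover have "0 < q h" using gap[of h] h by simp
  ultimately have "card ({0<..h} \<inter> insert 1 (norths g 0 n)) = rank_of M {0<..h}"
    using rank_prefix[of h] h by (simp add: g_def)
  then show ?thesis
    using flat conn lt C h2 by (intro fundamental_flatI) auto
qed

text \<open>As for the prefix, with the sides exchanged: \<open>e\<close> up to \<open>h\<close> is
  matched with \<open>Suc (p (e - 1))\<close>, at most \<open>p h\<close> because step
  \<open>h\<close> is North, hence below all indices used by the suffix. The East step after
  \<open>h\<close> gives connectedness. The circuit consists of 1 and the North steps of
  \<open>p\<close>, and 1 lies outside the suffix.\<close>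

lemma fundamental_flat_suffix:
  assumes h: "1 \<le> h" "h < n" and N: "p h = Suc (p (h - 1))" and E: "p (Suc h) = p h"
  shows "fundamental_flat M {h<..n}"
proof -
  \<comment> \<open>If \<open>h + 1 = n\<close>, the East step would give \<open>p h = r\<close>,
    leaving no room for \<open>q h\<close> above it. So the suffix has at least two
    elements.\<close>
  have h2: "h < n - 1"
    using gap[of h] path_bounds[of h] E p(3) h by (cases "Suc h = n") auto
  have card_p: "r = p h + card (norths p h n)"
    using card_norths[of h n p] unit_steps_subinterval[OF p(1), of h n] h p(3) by simp
  have "Suc (r - p h) \<le> rank_of M (insert e {h<..n})" if e: "0 < e" "e \<le> h" for e
  proof -
    have low: "p h < p x" if "x \<in> norths p h n" for x
    proof -
      have "h \<le> x - 1" "x - 1 \<le> n" "p x = Suc (p (x - 1))" using that unfolding norths_def by auto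
      then show ?thesis using unit_steps_bounds(1)[OF p(1), of h "x - 1"] by simp
    qed
    have "p (e - 1) \<le> p (h - 1)" using unit_steps_bounds(1)[OF p(1), of "e - 1" "h - 1"] e h by simp
    then have pe: "Suc (p (e - 1)) \<le> p h" using N by simp
    have "p (e - 1) \<le> p e" using unit_steps_bounds(1)[OF p(1), of "e - 1" e] e h by simp
    then have qe: "Suc (p (e - 1)) \<le> q e" using gap[of e] e h by simp
    have inj: "inj_on p (norths p h n)"
      using unit_steps_subinterval[OF p(1)] by (intro inj_on_norths) simp
    have e': "e \<notin> norths p h n" using e by (simp add: norths_def)
    have "p (x - 1) < p x \<and> p x \<le> q x" if "x \<in> norths p h n" for x
      using that p_le_q[of x] unfolding norths_def by auto
    moreover have "norths p h n \<subseteq> {0<..n}" by (auto simp: norths_def)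
    moreover have "Suc (p (e - 1)) \<notin> p ` norths p h n" using low pe by fastforce
    ultimately have "insert e (norths p h n) \<in> indeps M"
      using e e' h qe by (intro insert_indep_band_matroid[OF inj, where i = "Suc (p (e - 1))"]) auto
    then have "card (insert e (norths p h n)) \<le> rank_of M (insert e {h<..n})"
      by (intro card_le_rank_of) (auto simp: norths_def)
    then show ?thesis using card_p e' by simp
  qed
  then have "flat M {h<..n}"
    unfolding flat_def using rank_suffix[of h] h by (auto simp: Suc_le_eq not_less)
  moreover have "matroid_connected (restriction M {h<..n})"
  proof (rule matroid_connected_interval)
    \<comment> \<open>This is the highest path from height \<open>p h\<close> at \<open>h\<close>:
      North until it meets \<open>q\<close>.\<close>
    let ?hi = "\<lambda>j. min (q j) (p h + (j - h))"
    show "unit_steps h n p" using unit_steps_subinterval[OF p(1)] by simp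
    have "?hi (Suc j) = ?hi j \<or> ?hi (Suc j) = Suc (?hi j)" if "h \<le> j" "j < n" for j
      using unit_stepsD[OF q(1), of j] that by (auto simp: min_def)
    then show "unit_steps h n ?hi" unfolding unit_steps_def by blast
    show "p h = ?hi h" using p_le_q[of h] h by simp
    show "p n = ?hi n" using p q path_bounds[of h] h by simp
    show "p j < ?hi j" if "h < j" "j < n" for j
      using gap[of j] that h unit_steps_bounds(2)[OF p(1), of "Suc h" j] E by auto
    show "?hi j \<le> q j" for j by simp
    show "p j \<le> p j" for j ..
    show "q n - p h \<le> p n - p h" using p q by simp
  qed simp
  moreover have "rank_of M {h<..n} < matroid_rank M"
    using rank_suffix[of h] rank_ground N path_bounds[of h] h by simp
  moreover have C: "circuit M (insert 1 (norths p 0 n))" "spanning M (insert 1 (norths p 0 n))"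
    using spanning_circuit[OF p] gap h by simp_all
  have "{h<..n} \<inter> insert 1 (norths p 0 n) = norths p h n"
    using h by (auto simp: norths_def)
  then have "card ({h<..n} \<inter> insert 1 (norths p 0 n)) = rank_of M {h<..n}"
    using rank_suffix[of h] card_p h by simp
  ultimately show ?thesis
    using C h2 by (intro fundamental_flatI) auto
qed

lemma connectivity:
  assumes "\<not> uniform M"
  defines "k \<equiv> Min ((\<lambda>h. Suc (q h - p h)) ` corners)"
  shows "tutte_connectivity M = enat k"
    and "\<exists>X. fundamental_flat M X \<and> exact_separation M k X (ground M - X)"
proof -
  have fin: "finite corners" unfolding corners_def by simp
  have ne: "corners \<noteq> {}" using uniform_if_no_corners assms by blast
  have "k \<in> (\<lambda>h. Suc (q h - p h)) ` corners"
    unfolding k_def using fin ne by (intro Min_in) auto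
  then obtain h where h: "h \<in> corners" "k = Suc (q h - p h)" by blast
  have min: "k \<le> Suc (q c - p c)" if "c \<in> corners" for c
    unfolding k_def using fin that by (intro Min_le) auto
  have sep: "exact_separation M k {0<..h} {h<..n}"
    using corner_exact_separation h by simp
  \<comment> \<open>For a corner of the lower path the fundamental flat is the suffix, so the
    separation is also stated with its sides exchanged.\<close>
  then have sep': "exact_separation M k {h<..n} {0<..h}"
    unfolding exact_separation_def separation_def by (auto simp: add.commute)
  have "separation M k {0<..h} {h<..n}" using sep unfolding exact_separation_def by blast
  moreover from this have "(LEAST k. \<exists>X Y. separation M k X Y) = k"
    using separation_ge[OF h(1) min] by (intro Least_equality) blast+
  ultimately show "tutte_connectivity M = enat k" unfolding tutte_connectivity_def by auto
  have hn: "1 \<le> h" "h < n" using h unfolding corners_def by auto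
  have compl: "{0<..n} - {0<..h} = {h<..n}" "{0<..n} - {h<..n} = {0<..h}" using hn by auto
  consider "p h = Suc (p (h - 1))" "p (Suc h) = p h" | "q h = q (h - 1)" "q (Suc h) = Suc (q h)"
    using h unfolding corners_def by blast
  then show "\<exists>X. fundamental_flat M X \<and> exact_separation M k X (ground M - X)"
  proof cases
    case 1
    then show ?thesis using fundamental_flat_suffix[OF hn 1] sep' compl by auto
  next
    case 2
    then show ?thesis using fundamental_flat_prefix[OF hn 2] sep compl by auto
  qed
qed

end

section \<open>Lattice paths and their height functions\<close>

lemma length_lattice_path: "S \<in> lattice_paths m r \<Longrightarrow> length S = m + r"
proof -
  have "length xs = count_list xs East + count_list xs North" for xs :: path
  proof (induction xs)
    case (Cons x xs)
    then show ?case by (cases x) auto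
  qed simp
  then show "S \<in> lattice_paths m r \<Longrightarrow> length S = m + r" unfolding lattice_paths_def by simp
qed

lemma height_0 [simp]: "height S 0 = 0"
  unfolding height_def by simp

lemma height_Suc:
  "j < length S \<Longrightarrow> height S (Suc j) = height S j + (if S ! j = North then 1 else 0)"
  unfolding height_def by (simp add: take_Suc_conv_app_nth)

lemma height_beyond: "S \<in> lattice_paths m r \<Longrightarrow> m + r \<le> j \<Longrightarrow> height S j = r"
  using length_lattice_path[of S m r] unfolding height_def lattice_paths_def by simp

lemma unit_steps_height: "unit_steps 0 (length S) (height S)"
  unfolding unit_steps_def by (simp add: height_Suc)

lemma path_step_height:
  assumes "1 \<le> j" "j \<le> length S"
  shows "path_step S j = North \<longleftrightarrow> height S j = Suc (height S (j - 1))"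
    and "path_step S j = East \<longleftrightarrow> height S j = height S (j - 1)"
  using height_Suc[of "j - 1" S] assms unfolding path_step_def
  by (cases "S ! (j - 1)"; simp)+

lemma lattice_path_with_height:
  assumes g: "unit_steps 0 (m + r) g" "g 0 = 0" "g (m + r) = r"
  obtains S where "S \<in> lattice_paths m r" "\<And>j. j \<le> m + r \<Longrightarrow> height S j = g j"
proof -
  let ?S = "map (\<lambda>j. if g (Suc j) = Suc (g j) then North else East) [0..<m + r]"
  have height: "height ?S j = g j" if "j \<le> m + r" for j
    using that
  proof (induction j)
    case (Suc j)
    then show ?case using height_Suc[of j ?S] unit_stepsD[OF g(1), of j] by auto
  qed (simp add: g)
  have "count_list xs East = length xs - count_list xs North" for xs :: path
  proof (induction xs)
    case (Cons x xs)
    then show ?case using count_le_length[of xs North] by (cases x) (auto simp: Suc_diff_le)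
  qed simp
  moreover have "count_list ?S North = r"
    using height[of "m + r"] g(3) unfolding height_def by simp
  ultimately have "?S \<in> lattice_paths m r" unfolding lattice_paths_def by simp
  then show thesis using that height by blast
qed

locale lattice_path_pair =
  fixes m r :: nat and P Q :: path
  assumes P: "P \<in> lattice_paths m r" and Q: "Q \<in> lattice_paths m r" and PQ: "never_above P Q"

sublocale lattice_path_pair \<subseteq> band "m + r" r "height P" "height Q"
  using unit_steps_height[of P] unit_steps_height[of Q] height_beyond[OF P] height_beyond[OF Q] PQ
  by unfold_locales (auto simp: length_lattice_path[OF P] length_lattice_path[OF Q] never_above_def)

context lattice_path_pair
begin

section \<open>Identification of the lattice path matroid with the band matroid\<close>

lemma north_set_eq:
  assumes i: "1 \<le> i" "i \<le> r"
  shows "north_set m r P Q i = {j \<in> {0<..m + r}. height P (j - 1) < i \<and> i \<le> height Q j}"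
    (is "_ = ?N")
proof (intro equalityI subsetI)
  fix j assume "j \<in> north_set m r P Q i"
  then obtain S where S: "S \<in> lattice_paths m r" "never_above S Q" "never_above P S"
    and j: "1 \<le> j" "j \<le> length S" "path_step S j = North" "height S j = i"
    unfolding north_set_def paths_between_def is_ith_North_def by blast
  have "height S j = Suc (height S (j - 1))" using path_step_height(1)[OF j(1,2)] j(3) by simp
  moreover have "height P (j - 1) \<le> height S (j - 1)" "height S j \<le> height Q j"
    using S unfolding never_above_def by blast+
  ultimately show "j \<in> ?N" using j length_lattice_path[OF S(1)] by simp
next
  fix j assume "j \<in> ?N"
  then have j: "0 < j" "j \<le> m + r" "height P (j - 1) < i" "i \<le> height Q j" by auto
  \<comment> \<open>This path follows the upper one capped at height \<open>i - 1\<close>, steps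
    North at \<open>j\<close>, and then follows the lower one raised to at least
    \<open>i\<close>.\<close>
  define g where "g l = (if l < j then min (height Q l) (i - 1) else max (height P l) i)" for l
  have Qj: "i - 1 \<le> height Q (j - 1)" using unit_steps_pred[OF q(1), of j] j by auto
  have Pj: "height P j \<le> i" using unit_steps_pred[OF p(1), of j] j by auto
  have steps: "g (Suc l) = g l \<or> g (Suc l) = Suc (g l)" if "l < m + r" for l
  proof -
    consider "Suc l < j" | "Suc l = j" | "j \<le> l" by linarith
    then show ?thesis
    proof cases
      case 1
      then show ?thesis using unit_stepsD[OF q(1), of l] that by (auto simp: g_def)
    next
      case 2
      then show ?thesis using Qj Pj i by (auto simp: g_def)
    next
      case 3
      then show ?thesis using unit_stepsD[OF p(1), of l] that by (auto simp: g_def)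
    qed
  qed
  then have "unit_steps 0 (m + r) g" unfolding unit_steps_def by blast
  moreover have "g 0 = 0" "g (m + r) = r" using j i p q by (auto simp: g_def)
  ultimately obtain S where S: "S \<in> lattice_paths m r" "\<And>l. l \<le> m + r \<Longrightarrow> height S l = g l"
    using lattice_path_with_height by blast
  have "height P l \<le> g l \<and> g l \<le> height Q l" if "l \<le> m + r" for l
  proof (cases "l < j")
    case True
    then show ?thesis
      using p_le_q[OF that] unit_steps_bounds(1)[OF p(1), of l "j - 1"] j by (fastforce simp: g_def)
  next
    case False
    then show ?thesis
      using p_le_q[OF that] unit_steps_bounds(1)[OF q(1), of j l] that j by (auto simp: g_def)
  qed
  then have "height P l \<le> height S l \<and> height S l \<le> height Q l" for l
    using S(2)[of l] height_beyond[OF P, of l] height_beyond[OF Q, of l] height_beyond[OF S(1), of l]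
    by (cases "l \<le> m + r") auto
  then have "S \<in> paths_between m r P Q"
    unfolding paths_between_def never_above_def using S(1) by blast
  moreover have "g j = i" "g (j - 1) = i - 1" using Qj Pj j by (auto simp: g_def)
  then have "is_ith_North S i j"
    unfolding is_ith_North_def using j i S(2)[of j] S(2)[of "j - 1"] length_lattice_path[OF S(1)]
      path_step_height(1)[of j S] by simp
  ultimately show "j \<in> north_set m r P Q i" unfolding north_set_def by blast
qed

lemma lattice_path_matroid_eq: "lattice_path_matroid m r P Q = M"
proof -
  have "i \<in> {1..r} \<and> x \<in> north_set m r P Q i \<longleftrightarrow> height P (x - 1) < i \<and> i \<le> height Q x"
    if "x \<in> {0<..m + r}" for x i
    using that north_set_eq[of i] path_bounds(2)[of x] by (cases "1 \<le> i \<and> i \<le> r") auto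
  then have "(\<forall>x\<in>X. \<phi> x \<in> {1..r} \<and> x \<in> north_set m r P Q (\<phi> x)) \<longleftrightarrow>
      (\<forall>x\<in>X. height P (x - 1) < \<phi> x \<and> \<phi> x \<le> height Q x)" if "X \<subseteq> {0<..m + r}" for X \<phi>
    using that by blast
  moreover have "{1..m + r} = {0<..m + r}" by auto
  ultimately show ?thesis
    unfolding lattice_path_matroid_def band_matroid_def transversal_matroid_def by auto
qed

lemma card_incidence:
  assumes "0 < j" "j \<le> m + r"
  shows "card (incidence m r P Q {j}) = height Q j - height P (j - 1)"
proof -
  have "incidence m r P Q {j} = {height P (j - 1)<..height Q j}"
    unfolding incidence_def using assms north_set_eq path_bounds(2)[of j] by auto
  then show ?thesis by simp
qed

lemma min_corner_incidence_eq:
  "min_corner_incidence m r P Q = Min ((\<lambda>h. Suc (height Q h - height P h)) ` corners)"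
proof -
  have len: "length P = m + r" "length Q = m + r" using length_lattice_path P Q by auto
  have NE: "NE_corner P h \<longleftrightarrow> 1 \<le> h \<and> h < m + r \<and>
      height P h = Suc (height P (h - 1)) \<and> height P (Suc h) = height P h" for h
    unfolding NE_corner_def using path_step_height[of h P] path_step_height[of "h + 1" P] len by auto
  have EN: "EN_corner Q h \<longleftrightarrow> 1 \<le> h \<and> h < m + r \<and>
      height Q h = height Q (h - 1) \<and> height Q (Suc h) = Suc (height Q h)" for h
    unfolding EN_corner_def using path_step_height[of h Q] path_step_height[of "h + 1" Q] len by auto
  have NE_card: "card (incidence m r P Q {h}) = Suc (height Q h - height P h)" if "NE_corner P h" for h
    using that p_le_q[of h] card_incidence[of h] unfolding NE by simp
  have EN_card: "card (incidence m r P Q {Suc h}) = Suc (height Q h - height P h)" if "EN_corner Q h" for h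
    using that p_le_q[of h] card_incidence[of "Suc h"] unfolding EN by (simp add: Suc_diff_le)
  have corners: "corners = {h. NE_corner P h \<or> EN_corner Q h}"
    unfolding corners_def NE EN by blast
  have "{card (incidence m r P Q {j}) | j. NE_corner P j \<or> EN_corner Q (j - 1)} =
      (\<lambda>h. Suc (height Q h - height P h)) ` corners"
  proof (intro equalityI subsetI)
    fix k assume "k \<in> {card (incidence m r P Q {j}) | j. NE_corner P j \<or> EN_corner Q (j - 1)}"
    then obtain j where k: "k = card (incidence m r P Q {j})" and j: "NE_corner P j \<or> EN_corner Q (j - 1)"
      by blast
    from j show "k \<in> (\<lambda>h. Suc (height Q h - height P h)) ` corners"
    proof
      assume "NE_corner P j"
      then show ?thesis using NE_card corners k by blast
    next
      assume EN_j: "EN_corner Q (j - 1)"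
      \<comment> \<open>A corner position is at least 1, which excludes \<open>j = 0\<close>, where
        \<open>j - 1\<close> is truncated to 0.\<close>
      then have "Suc (j - 1) = j" unfolding EN_corner_def by (cases j) auto
      then have "k = Suc (height Q (j - 1) - height P (j - 1))" using EN_card[OF EN_j] k by simp
      then show ?thesis using EN_j corners by blast
    qed
  next
    fix k assume "k \<in> (\<lambda>h. Suc (height Q h - height P h)) ` corners"
    then obtain h where k: "k = Suc (height Q h - height P h)" and h: "NE_corner P h \<or> EN_corner Q h"
      using corners by blast
    from h show "k \<in> {card (incidence m r P Q {j}) | j. NE_corner P j \<or> EN_corner Q (j - 1)}"
    proof (rule disjE)
      assume "NE_corner P h"
      then show ?thesis using NE_card[of h] k by (intro CollectI exI[of _ h]) simp
    next
      assume "EN_corner Q h"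
      then show ?thesis using EN_card[of h] k by (intro CollectI exI[of _ "Suc h"]) simp
    qed
  qed
  then show ?thesis unfolding min_corner_incidence_def by simp
qed

end

theorem theorem7p4:
  fixes m r :: nat and P Q :: path and M :: "nat indep_system"
  assumes P: "P \<in> lattice_paths m r"
    and Q: "Q \<in> lattice_paths m r"
    and PQ: "never_above P Q"
    and M: "M = lattice_path_matroid m r P Q"
    and connected: "matroid_connected M"
    and not_uniform: "\<not> uniform M"
  shows "tutte_connectivity M = enat (min_corner_incidence m r P Q) \<and>
         (\<exists>X. fundamental_flat M X \<and>
              exact_separation M (min_corner_incidence m r P Q) X (ground M - X))"
proof -
  interpret lattice_path_pair m r P Q
    by unfold_locales (fact P Q PQ)+
  note M_eq = M[unfolded lattice_path_matroid_eq]
  interpret connected_band "m + r" r "height P" "height Q"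
    using connected_gap connected unfolding M_eq by unfold_locales blast
  show ?thesis
    using connectivity not_uniform unfolding M_eq min_corner_incidence_eq by blast
qed

end
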